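(* Consider the partial backorder inventory system with positive lead time $\tau\ge1$. Assume that $\mathbb{P}[D_1=0]=\alpha_0>0$ and $\mathbb{P}[D_1=1]=\alpha_1>0$. For any fixed initial state $X_1=(I_1,B_0,Q_{1-\tau},\dots,Q_0)={\bf x}$, $$\frac{\max_{(s,q)}\mathcal{C}^{(s,q)}(r,h;{\bf x})}{\max_{\pi\in\mathcal{A}}\mathcal{C}^\pi(r,h;{\bf x})}\longrightarrow1\qquad\text{as } r\to\infty,$$ where $\mathcal{C}^{(s,q)}$ is the long-run average profit under the $(s,q)$-policy and $\mathcal{A}$ is the set of all admissible policies (which may use full information on the backorders).
   Context: Notation: $x^+=\max\{x,0\}$, $x\wedge y=\min(x,y)$, $a_{[i,k]}=\sum_{j=i}^k a_j$ (equal to $0$ if $i>k$). Partial backorder system. The lead time is a fixed integer $\tau\ge1$, the patience parameter is $p\in[0,1]$, the sale price per unit is $r>0$ and the holding cost per unit per period is $h>0$. Demands $D_1,D_2,\dots$ are i.i.d. nonnegative integer-valued with finite mean $d$. For each period $i$, $\{\xi_{i;\ell}:\ell\ge1\}$ are i.i.d. Bernoulli random variables with mean $p$; these families are independent over $i$ and independent of the demands. The state at the beginning of period $i$ is $X_i=(I_i,B_{i-1},Q_{i-\tau},\dots,Q_{i-1})$ (on-hand inventory, backorders, outstanding orders), nonnegative integers with $I_iB_{i-1}=0$. In period $i$: the order $Q_{i-\tau}$ arrives; an order quantity $Q_i\in\{0,1,2,\dots\}$ is chosen depending on $X_i$ (it is delivered at the start of period $i+\tau$); demand $D_i$ is realized;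 the unmet demand is $U_i=(B_{i-1}+D_i-I_i-Q_{i-\tau})^+$ and $I_{i+1}=(I_i+Q_{i-\tau}-B_{i-1}-D_i)^+$; $B_i=\xi_{i;[1,U_i]}$ is backordered and $L_i=U_i-B_i$ is lost. A sequence $\pi=(Q_1,Q_2,\dots)$ of such order quantities is an admissible policy; $\mathcal{A}$ is the set of admissible policies. The long-run average profit under $\pi$ from initial state ${\bf x}$ is $$\mathcal{C}^\pi(r,h;{\bf x})=\liminf_{N\to\infty}\frac1N\mathbb{E}\Big[\sum_{i=1}^N \Big(r\cdot\big((I_i+Q_{i-\tau})\wedge(B_{i-1}+D_i)\big)-h\cdot(I_i+Q_{i-\tau}-B_{i-1}-D_i)^+\Big)\Big|X_1={\bf x}\Big].$$ For nonnegative integers $s,q$, the $(s,q)$-policy (which does not use the backorder $B_{i-1}$) orders $$Q_i=\Big(s+q\cdot\mathbb{I}_{\{I_i=0\}}-I_i-Q_{[i-\tau,i-1]}\Big)^+,\qquad i\ge1.$$ *)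

theory Defs
  imports "HOL-Probability.Probability"
begin

text \<open>
  The state at the beginning of period \<open>i\<close> is \<open>(I\<^sub>i, B\<^sub>i\<^sub>-\<^sub>1, [Q\<^sub>i\<^sub>-\<^sub>\<tau>, \<dots>, Q\<^sub>i\<^sub>-\<^sub>1])\<close>, oldest
  outstanding order first.
\<close>

type_synonym state = "nat \<times> nat \<times> nat list"

definition valid_state :: "nat \<Rightarrow> state \<Rightarrow> bool" where
  "valid_state \<tau> = (\<lambda>(I, B, Qs). length Qs = \<tau> \<and> I * B = 0)"

text \<open>
  \<open>\<pi> i X\<close> is the order quantity in period \<open>i\<close> when the state is \<open>X\<close>. Every such function is an
  admissible policy.
\<close>

type_synonym policy = "nat \<Rightarrow> state \<Rightarrow> nat"

text \<open>Subtraction on naturals is truncated, i.e. it is the positive part of the difference.\<close>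

definition sq_policy :: "nat \<Rightarrow> nat \<Rightarrow> policy" where
  "sq_policy s q = (\<lambda>i (I, B, Qs). s + q * of_bool (I = 0) - I - sum_list Qs)"

definition next_state :: "nat \<Rightarrow> nat \<Rightarrow> (nat \<Rightarrow> nat) \<Rightarrow> state \<Rightarrow> state" where
  "next_state ordered demand stay = (\<lambda>(I, B, Qs).
     let available = I + hd Qs; unmet = B + demand - available
     in (available - (B + demand), \<Sum>l = 1..unmet. stay l, tl Qs @ [ordered]))"

definition period_profit :: "real \<Rightarrow> real \<Rightarrow> nat \<Rightarrow> state \<Rightarrow> real" where
  "period_profit r h demand = (\<lambda>(I, B, Qs).
     r * real (min (I + hd Qs) (B + demand)) - h * real (I + hd Qs - (B + demand)))"

text \<open>
  Periods are numbered from 1, so \<open>state_after \<dots> n\<close> is the state \<open>X\<^sub>n\<^sub>+\<^sub>1\<close> reached at the beginning of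
  period \<open>n + 1\<close>, and \<open>x\<close> is \<open>X\<^sub>1\<close>.
\<close>

primrec state_after ::
  "(nat \<Rightarrow> 'a \<Rightarrow> nat) \<Rightarrow> (nat \<Rightarrow> nat \<Rightarrow> 'a \<Rightarrow> nat) \<Rightarrow> policy \<Rightarrow> state \<Rightarrow> 'a \<Rightarrow> nat \<Rightarrow> state" where
  "state_after D \<xi> \<pi> x \<omega> 0 = x"
| "state_after D \<xi> \<pi> x \<omega> (Suc n) =
     next_state (\<pi> (Suc n) (state_after D \<xi> \<pi> x \<omega> n)) (D (Suc n) \<omega>) (\<lambda>l. \<xi> (Suc n) l \<omega>)
       (state_after D \<xi> \<pi> x \<omega> n)"

text \<open>
  The Bochner integral is 0 on non-integrable functions, but some admissible policies order so much
  that the expected holding cost is infinite. Their profit has to be \<open>-\<infinity>\<close>, hence the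
  extended-real expectation (which agrees with the Bochner integral on integrable functions).
\<close>

definition ext_expectation :: "'a measure \<Rightarrow> ('a \<Rightarrow> real) \<Rightarrow> ereal" where
  "ext_expectation M f =
     enn2ereal (\<integral>\<^sup>+ \<omega>. ennreal (f \<omega>) \<partial>M) - enn2ereal (\<integral>\<^sup>+ \<omega>. ennreal (- f \<omega>) \<partial>M)"

definition average_profit ::
  "'a measure \<Rightarrow> (nat \<Rightarrow> 'a \<Rightarrow> nat) \<Rightarrow> (nat \<Rightarrow> nat \<Rightarrow> 'a \<Rightarrow> nat) \<Rightarrow>
     policy \<Rightarrow> real \<Rightarrow> real \<Rightarrow> state \<Rightarrow> ereal" where
  "average_profit M D \<xi> \<pi> r h x =
     liminf (\<lambda>N. ext_expectation M
       (\<lambda>\<omega>. \<Sum>i = 1..N. period_profit r h (D i \<omega>) (state_after D \<xi> \<pi> x \<omega> (i - 1))) / ereal (real N))"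

text \<open>
  \<open>D i\<close> is the demand in period \<open>i\<close>, and \<open>\<xi> i l\<close> is the indicator that the \<open>l\<close>-th customer with
  unmet demand in period \<open>i\<close> stays. The single independence assumption on the joint family contains
  independence within the demands, within the \<open>\<xi>\<close>, and between them.
\<close>

locale partial_backorder_system = prob_space M for M :: "'a measure" +
  fixes \<tau> :: nat and p :: real
    and D :: "nat \<Rightarrow> 'a \<Rightarrow> nat" and \<xi> :: "nat \<Rightarrow> nat \<Rightarrow> 'a \<Rightarrow> nat"
  assumes lead_time: "\<tau> \<ge> 1"
    and patience: "0 \<le> p" "p \<le> 1"
    and indep: "indep_vars (\<lambda>_. count_space UNIV) (case_sum D (\<lambda>(i, l). \<xi> i l))
                  ({1..} <+> {1..} \<times> {1..})"
    and demand_identical: "\<And>i. i \<ge> 1 \<Longrightarrow>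
          distr M (count_space UNIV) (D i) = distr M (count_space UNIV) (D 1)"
    and demand_mean: "integrable M (\<lambda>\<omega>. real (D 1 \<omega>))"
    and stay_bernoulli: "\<And>i l. i \<ge> 1 \<Longrightarrow> l \<ge> 1 \<Longrightarrow>
          distr M (count_space UNIV) (\<xi> i l) = measure_pmf (map_pmf of_bool (bernoulli_pmf p))"

end

theory Submission
  imports Defs "HOL-Real_Asymp.Real_Asymp"
begin

text \<open>
  Sales never exceed demand, so every policy earns at most \<open>r d\<close> per period. It therefore suffices
  that the base-stock policies \<open>(s, 0)\<close> sell \<open>d - o(1)\<close> per period as \<open>s \<rightarrow> \<infinity>\<close>: their holding cost is
  at most \<open>h s\<close>, which is negligible against \<open>r\<close>.

  Let \<open>A\<^sub>n\<close> and \<open>S\<^sub>n\<close> be the cumulative demand (including \<open>B\<^sub>0\<close>) and sales. If \<open>s\<close> is at least the initial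
  inventory position, period \<open>n\<close> can sell up to \<open>s + S\<^sub>n\<^sub>-\<^sub>1\<^sub>-\<^sub>\<tau> - S\<^sub>n\<^sub>-\<^sub>1\<close> units. Hence the deficit \<open>A\<^sub>n - S\<^sub>n\<close> is at
  most \<open>A\<^sub>n\<^sub>-\<^sub>1 - S\<^sub>n\<^sub>-\<^sub>1\<close> when all the demand is met, and otherwise equals
  \<open>A\<^sub>n\<^sub>-\<^sub>1\<^sub>-\<^sub>\<tau> - S\<^sub>n\<^sub>-\<^sub>1\<^sub>-\<^sub>\<tau>\<close> plus the demand of the last \<open>\<tau> + 1\<close> periods minus \<open>s\<close>. With \<open>s = (\<tau> + 1) m\<close>, the
  deficit grows by at most \<open>(\<tau> + 1) E(D\<^sub>1 - m)\<^sup>+\<close> per period on average, and this vanishes as \<open>m \<rightarrow> \<infinity>\<close>.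
  The estimate is pathwise and holds for every patience parameter.
\<close>

section \<open>Pathwise accounting of sales, demand and profit\<close>

definition sales :: "nat \<Rightarrow> state \<Rightarrow> nat" where
  "sales demand = (\<lambda>(I, B, Qs). min (I + hd Qs) (B + demand))"

text \<open>Holding cost is charged on the stock left at the end of the period, which is the on-hand
  component of the next state. That component does not depend on \<open>ordered\<close> or
  \<open>stay\<close>, so both are free.\<close>

lemma period_profit_eq_sales:
  "period_profit r h demand X =
     r * real (sales demand X) - h * real (fst (next_state ordered demand stay X))"
  by (simp add: period_profit_def sales_def next_state_def Let_def split: prod.splits)

lemma base_stock_order: "sq_policy s 0 i (I, B, Qs) = s - I - sum_list Qs"
  by (simp add: sq_policy_def)

context
  fixes D :: "nat \<Rightarrow> 'a \<Rightarrow> nat" and \<xi> :: "nat \<Rightarrow> nat \<Rightarrow> 'a \<Rightarrow> nat"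
    and x :: state and \<omega> :: 'a
begin

definition total_sales :: "policy \<Rightarrow> nat \<Rightarrow> nat" where
  "total_sales \<pi> n = (\<Sum>i = 1..n. sales (D i \<omega>) (state_after D \<xi> \<pi> x \<omega> (i - 1)))"

definition total_demand :: "nat \<Rightarrow> nat" where
  "total_demand n = fst (snd x) + (\<Sum>i = 1..n. D i \<omega>)"

lemma total_sales_Suc:
  "total_sales \<pi> (Suc n) = total_sales \<pi> n + sales (D (Suc n) \<omega>) (state_after D \<xi> \<pi> x \<omega> n)"
  by (simp add: total_sales_def)

lemma total_demand_Suc: "total_demand (Suc n) = total_demand n + D (Suc n) \<omega>"
  by (simp add: total_demand_def)

lemma total_demand_mono: "m \<le> n \<Longrightarrow> total_demand m \<le> total_demand n"
  by (rule lift_Suc_mono_le[of total_demand]) (simp_all add: total_demand_Suc)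

lemma total_demand_diff:
  assumes "k \<le> n"
  shows "total_demand n = total_demand k + (\<Sum>i = Suc k..n. D i \<omega>)"
  using assms by (induction n rule: dec_induct) (simp_all add: total_demand_Suc)

lemma total_profit_eq:
  "(\<Sum>i = 1..N. period_profit r h (D i \<omega>) (state_after D \<xi> \<pi> x \<omega> (i - 1))) =
     r * real (total_sales \<pi> N) - h * (\<Sum>i = 1..N. real (fst (state_after D \<xi> \<pi> x \<omega> i)))"
proof (induction N)
  case 0
  show ?case by (simp add: total_sales_def)
next
  case (Suc N)
  show ?case
    using Suc.IH
      period_profit_eq_sales[of r h "D (Suc N) \<omega>" "state_after D \<xi> \<pi> x \<omega> N"
        "\<pi> (Suc N) (state_after D \<xi> \<pi> x \<omega> N)" "\<lambda>l. \<xi> (Suc N) l \<omega>"]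
    by (simp add: total_sales_Suc algebra_simps)
qed

lemma total_sales_le_total_demand:
  assumes "\<And>i l. i \<ge> 1 \<Longrightarrow> l \<ge> 1 \<Longrightarrow> \<xi> i l \<omega> \<le> 1"
  shows "total_sales \<pi> n \<le> total_demand n"
proof -
  \<comment> \<open>Outstanding backorders are added to make the bound inductive: they may be sold
    later, but at most the unmet units stay, so no unit of demand is counted twice.\<close>
  have "total_sales \<pi> n + fst (snd (state_after D \<xi> \<pi> x \<omega> n)) \<le> total_demand n"
  proof (induction n)
    case 0
    show ?case by (simp add: total_sales_def total_demand_def)
  next
    case (Suc n)
    obtain I B Qs where X: "state_after D \<xi> \<pi> x \<omega> n = (I, B, Qs)"
      by (cases "state_after D \<xi> \<pi> x \<omega> n") auto
    define U where "U = B + D (Suc n) \<omega> - (I + hd Qs)"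
    have "(\<Sum>l = 1..U. \<xi> (Suc n) l \<omega>) \<le> (\<Sum>l = 1..U. 1)"
      by (intro sum_mono assms) auto
    hence "(\<Sum>l = 1..U. \<xi> (Suc n) l \<omega>) \<le> U" by simp
    thus ?case
      using Suc.IH
      by (simp add: X next_state_def total_sales_Suc total_demand_Suc sales_def Let_def
          flip: U_def) (simp add: U_def)
  qed
  thus ?thesis by simp
qed

section \<open>Pathwise sales deficit of base-stock policies\<close>

context
  fixes \<tau> s :: nat
  assumes lead_time: "\<tau> \<ge> 1"
    and length_pipeline: "length (snd (snd x)) = \<tau>"
    and initial_position: "fst x + sum_list (snd (snd x)) \<le> s"
begin

abbreviation base_stock_state :: "nat \<Rightarrow> state" where
  "base_stock_state \<equiv> state_after D \<xi> (sq_policy s 0) x \<omega>"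

abbreviation base_stock_sales :: "nat \<Rightarrow> nat" where
  "base_stock_sales \<equiv> total_sales (sq_policy s 0)"

lemma length_base_stock_pipeline: "length (snd (snd (base_stock_state n))) = \<tau>"
  using lead_time length_pipeline
  by (induction n) (auto simp: next_state_def Let_def split: prod.splits)

text \<open>Ordering raises the position to exactly \<open>s\<close>; delivery only moves units from
  the pipeline to stock, and demand only depletes stock.\<close>

lemma base_stock_position_le:
  "fst (base_stock_state n) + sum_list (snd (snd (base_stock_state n))) \<le> s"
proof (induction n)
  case 0
  show ?case using initial_position by simp
next
  case (Suc n)
  obtain I B Qs where X: "base_stock_state n = (I, B, Qs)"
    by (cases "base_stock_state n") auto
  obtain Q Qs' where "Qs = Q # Qs'"
    using length_base_stock_pipeline[of n] lead_time X by (cases Qs) auto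
  with Suc.IH X show ?case
    by (simp add: next_state_def base_stock_order Let_def)
qed

text \<open>
  Everything that has been sold, is on hand, or arrives within the next \<open>k\<close> periods. Advancing
  time by one period only shortens the horizon by one.
\<close>

definition pipeline_supply :: "nat \<Rightarrow> nat \<Rightarrow> nat" where
  "pipeline_supply n k = base_stock_sales n + fst (base_stock_state n)
     + sum_list (take k (snd (snd (base_stock_state n))))"

text \<open>A delivered unit is either sold or kept, so it stays counted; as
  \<open>k < \<tau>\<close>, the new order lies beyond the horizon.\<close>

lemma pipeline_supply_Suc:
  assumes "k < \<tau>"
  shows "pipeline_supply (Suc n) k = pipeline_supply n (Suc k)"
proof -
  obtain I B Qs where X: "base_stock_state n = (I, B, Qs)"
    by (cases "base_stock_state n") auto
  obtain Q Qs' where Q: "Qs = Q # Qs'"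
    using length_base_stock_pipeline[of n] lead_time X by (cases Qs) auto
  have "length Qs' \<ge> k"
    using length_base_stock_pipeline[of n] assms X Q by simp
  thus ?thesis
    by (simp add: pipeline_supply_def X Q next_state_def Let_def total_sales_Suc sales_def)
qed

text \<open>The horizon now includes the order just placed, which fills the position up to
  \<open>s\<close>; deliveries and sales conserve the total.\<close>

lemma pipeline_supply_lead_time: "pipeline_supply (Suc n) \<tau> = base_stock_sales n + s"
proof -
  obtain I B Qs where X: "base_stock_state n = (I, B, Qs)"
    by (cases "base_stock_state n") auto
  obtain Q Qs' where Q: "Qs = Q # Qs'"
    using length_base_stock_pipeline[of n] lead_time X by (cases Qs) auto
  have "length Qs' = \<tau> - 1"
    using length_base_stock_pipeline[of n] X Q by simp
  thus ?thesis
    using base_stock_position_le[of n] lead_time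
    by (simp add: pipeline_supply_def X Q next_state_def Let_def total_sales_Suc sales_def
        base_stock_order)
qed

lemma pipeline_supply_shift: "j < \<tau> \<Longrightarrow> pipeline_supply (n + j) (\<tau> - j) = pipeline_supply n \<tau>"
proof (induction j)
  case (Suc j)
  thus ?case using pipeline_supply_Suc[of "\<tau> - Suc j" "n + j"] by (simp add: Suc_diff_Suc)
qed simp

text \<open>The order of period \<open>n + 1\<close> is the last to arrive by period
  \<open>n + \<tau> + 1\<close>, so cumulative sales through that period are capped by those through
  period \<open>n\<close> plus \<open>s\<close>.\<close>

lemma pipeline_supply_one: "pipeline_supply (n + \<tau>) 1 = base_stock_sales n + s"
  using pipeline_supply_shift[of "\<tau> - 1" "Suc n"] pipeline_supply_lead_time[of n] lead_time by simp

lemma base_stock_sales_Suc_cases: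
  obtains
    (demand) "base_stock_sales (Suc n) \<ge> base_stock_sales n + D (Suc n) \<omega>"
  | (stock) "base_stock_sales (Suc n) = pipeline_supply n 1"
proof -
  obtain I B Qs where X: "base_stock_state n = (I, B, Qs)"
    by (cases "base_stock_state n") auto
  obtain Q Qs' where Q: "Qs = Q # Qs'"
    using length_base_stock_pipeline[of n] lead_time X by (cases Qs) auto
  show thesis
  proof (cases "I + Q \<le> B + D (Suc n) \<omega>")
    case True
    thus ?thesis
      by (intro that(2)) (simp add: pipeline_supply_def X Q total_sales_Suc sales_def)
  next
    case False
    thus ?thesis
      by (intro that(1)) (simp add: X Q total_sales_Suc sales_def)
  qed
qed

text \<open>The induction is strong because a period that exhausts the stock refers back \<tau> + 1
  periods, whereas one that meets its demand refers back one. The first \<tau> periods are absorbed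
  in the constant \<open>total_demand \<tau>\<close>.\<close>

lemma total_demand_le_base_stock_sales:
  assumes s: "s = (\<tau> + 1) * m"
  shows "total_demand n \<le> base_stock_sales n + total_demand \<tau>
           + (\<Sum>j = Suc \<tau>..n. \<Sum>k = j - \<tau>..j. D k \<omega> - m)"
proof (induction n rule: less_induct)
  case (less n)
  show ?case
  proof (cases "n \<le> \<tau>")
    case True
    thus ?thesis using total_demand_mono[of n \<tau>] by simp
  next
    case False
    then obtain n' where n: "n = Suc (n' + \<tau>)"
      by (metis add.commute add_Suc_right less_iff_Suc_add not_le)
    let ?E = "\<lambda>j. \<Sum>k = j - \<tau>..j. D k \<omega> - m"
    show ?thesis
    proof (cases rule: base_stock_sales_Suc_cases[of "n' + \<tau>"])
      case demand
      thus ?thesis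
        using less.IH[of "n' + \<tau>"] by (simp add: n total_demand_Suc)
    next
      case stock
      \<comment> \<open>Jumping back to \<open>n'\<close> skips the error terms of the periods in
        between, which are nonnegative.\<close>
      have "(\<Sum>j = Suc \<tau>..n'. ?E j) \<le> (\<Sum>j = Suc \<tau>..n' + \<tau>. ?E j)"
        by (intro sum_mono2) auto
      hence E: "(\<Sum>j = Suc \<tau>..n'. ?E j) + ?E n \<le> (\<Sum>j = Suc \<tau>..n. ?E j)"
        by (simp add: n)
      \<comment> \<open>Each demand is at most \<open>m\<close> plus its excess; the \<tau> + 1
        copies of \<open>m\<close> add up to \<open>s\<close> and cancel against the cap on
        sales.\<close>
      have "(\<Sum>k = Suc n'..n. D k \<omega>) \<le> (\<Sum>k = Suc n'..n. m + (D k \<omega> - m))"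
        by (intro sum_mono) auto
      also have "\<dots> = s + ?E n"
        unfolding sum.distrib by (simp add: n s)
      finally show ?thesis
        using less.IH[of n'] E stock pipeline_supply_one[of n'] total_demand_diff[of n' n]
        by (simp add: n)
    qed
  qed
qed

end

end

section \<open>Extended expectations and limit facts\<close>

lemma ext_expectation_mono:
  assumes "AE \<omega> in M. f \<omega> \<le> g \<omega>"
  shows "ext_expectation M f \<le> ext_expectation M g"
  unfolding ext_expectation_def
  using assms
  by (intro ereal_minus_mono; unfold less_eq_ennreal.rep_eq[symmetric])
    (auto intro!: nn_integral_mono_AE ennreal_leI elim!: eventually_mono)

lemma ext_expectation_eq_integral:
  assumes "integrable M f"
  shows "ext_expectation M f = ereal (integral\<^sup>L M f)"
proof -
  have fin: "(\<integral>\<^sup>+ \<omega>. ennreal (f \<omega>) \<partial>M) < \<top>" "(\<integral>\<^sup>+ \<omega>. ennreal (- f \<omega>) \<partial>M) < \<top>"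
    using assms by (auto simp: real_integrable_def less_top)
  show ?thesis
    unfolding ext_expectation_def real_lebesgue_integral_def[OF assms]
    using fin
    by (cases "\<integral>\<^sup>+ \<omega>. ennreal (f \<omega>) \<partial>M"; cases "\<integral>\<^sup>+ \<omega>. ennreal (- f \<omega>) \<partial>M") auto
qed

lemma tendsto_affine_over_index:
  fixes u v :: real
  shows "(\<lambda>N. (u + real N * v) / real N) \<longlonglongrightarrow> v"
proof -
  have "(\<lambda>N. u / real N + v) \<longlonglongrightarrow> 0 + v"
    by (intro tendsto_intros lim_const_over_n)
  moreover have "\<forall>\<^sub>F N in sequentially. u / real N + v = (u + real N * v) / real N"
    using eventually_gt_at_top[of 0] by eventually_elim (simp add: field_simps)
  ultimately show ?thesis
    using tendsto_cong by fastforce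
qed

text \<open>For each outcome the excess is eventually 0, and it is dominated by
  \<open>f\<close>.\<close>

lemma tendsto_integral_excess:
  fixes f :: "'a \<Rightarrow> nat"
  assumes f: "integrable M (\<lambda>\<omega>. real (f \<omega>))"
  shows "(\<lambda>m. \<integral>\<omega>. real (f \<omega> - m) \<partial>M) \<longlonglongrightarrow> 0"
proof -
  have [measurable]: "(\<lambda>\<omega>. real (f \<omega>)) \<in> borel_measurable M"
    using f by simp
  have eq: "real (f \<omega> - m) = max 0 (real (f \<omega>) - real m)" for \<omega> m
    by (simp add: of_nat_diff_if max_def)
  have "(\<lambda>m. \<integral>\<omega>. real (f \<omega> - m) \<partial>M) \<longlonglongrightarrow> (\<integral>\<omega>. 0 \<partial>M)"
  proof (rule integral_dominated_convergence[OF _ _ f])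
    have "eventually (\<lambda>m. real (f \<omega> - m) = 0) sequentially" for \<omega>
      using eventually_ge_at_top[of "f \<omega>"] by eventually_elim simp
    thus "AE \<omega> in M. (\<lambda>m. real (f \<omega> - m)) \<longlonglongrightarrow> 0"
      by (intro AE_I2 tendsto_eventually)
  qed (simp_all add: eq)
  thus ?thesis by simp
qed

section \<open>Upper and lower bounds on the average profit\<close>

context partial_backorder_system
begin

lemma demand_measurable [measurable]: "i \<ge> 1 \<Longrightarrow> D i \<in> measurable M (count_space UNIV)"
  using indep by (auto simp: indep_vars_def dest!: bspec[where x = "Inl i"])

lemma stay_measurable: "i \<ge> 1 \<Longrightarrow> l \<ge> 1 \<Longrightarrow> \<xi> i l \<in> measurable M (count_space UNIV)"
  using indep by (auto simp: indep_vars_def dest!: bspec[where x = "Inr (i, l)"])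

lemma AE_stay_le_one: "AE \<omega> in M. \<forall>i\<ge>1. \<forall>l\<ge>1. \<xi> i l \<omega> \<le> 1"
proof -
  have "AE \<omega> in M. \<xi> i l \<omega> \<le> 1" if il: "i \<ge> 1" "l \<ge> 1" for i l
  proof -
    have "AE k in measure_pmf (map_pmf of_bool (bernoulli_pmf p)). k \<le> (1 :: nat)"
      by (auto simp: AE_measure_pmf_iff)
    thus ?thesis
      unfolding stay_bernoulli[OF il, symmetric] by (rule AE_distrD[OF stay_measurable[OF il]])
  qed
  thus ?thesis by (simp add: AE_all_countable)
qed

lemma integrable_demand_iff:
  fixes f :: "nat \<Rightarrow> real"
  assumes i: "i \<ge> 1"
  shows "integrable M (\<lambda>\<omega>. f (D i \<omega>)) \<longleftrightarrow> integrable M (\<lambda>\<omega>. f (D 1 \<omega>))"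
  using integrable_distr_eq[of "D i" M "count_space UNIV" f] demand_measurable[OF i]
    integrable_distr_eq[of "D 1" M "count_space UNIV" f] demand_measurable[of 1]
    demand_identical[OF i] by simp

lemma expectation_demand:
  fixes f :: "nat \<Rightarrow> real"
  assumes i: "i \<ge> 1"
  shows "expectation (\<lambda>\<omega>. f (D i \<omega>)) = expectation (\<lambda>\<omega>. f (D 1 \<omega>))"
  using integral_distr[of "D i" M "count_space UNIV" f] demand_measurable[OF i]
    integral_distr[of "D 1" M "count_space UNIV" f] demand_measurable[of 1]
    demand_identical[OF i] by simp

lemma integrable_demand: "i \<ge> 1 \<Longrightarrow> integrable M (\<lambda>\<omega>. real (D i \<omega>))"
  using integrable_demand_iff[of i real] demand_mean by simp

lemma integrable_excess:
  assumes i: "i \<ge> 1"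
  shows "integrable M (\<lambda>\<omega>. real (D i \<omega> - m))"
  by (rule Bochner_Integration.integrable_bound[OF integrable_demand[OF i]])
    (use demand_measurable[OF i] in auto)

definition mean_demand :: real where
  "mean_demand = expectation (\<lambda>\<omega>. real (D 1 \<omega>))"

definition mean_excess :: "nat \<Rightarrow> real" where
  "mean_excess m = expectation (\<lambda>\<omega>. real (D 1 \<omega> - m))"

text \<open>The indicator of \<open>D 1 = 1\<close> is at most \<open>D 1\<close>.\<close>

lemma mean_demand_pos:
  assumes "\<P>(\<omega> in M. D 1 \<omega> = 1) > 0"
  shows "mean_demand > 0"
proof -
  have [measurable]: "D 1 \<in> measurable M (count_space UNIV)"
    by (rule demand_measurable) simp
  have "\<P>(\<omega> in M. D 1 \<omega> = 1) = expectation (indicator {\<omega> \<in> space M. D 1 \<omega> = 1})"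
    by (simp add: Int_absorb1 Collect_restrict)
  also have "\<dots> \<le> mean_demand"
    unfolding mean_demand_def
    by (intro integral_mono demand_mean integrable_real_indicator)
      (auto simp: indicator_def emeasure_eq_measure)
  finally show ?thesis using assms by simp
qed

lemma expectation_total_demand:
  "integrable M (\<lambda>\<omega>. real (total_demand D x \<omega> n))"
  "expectation (\<lambda>\<omega>. real (total_demand D x \<omega> n)) = real (fst (snd x)) + real n * mean_demand"
proof -
  have int: "integrable M (\<lambda>\<omega>. \<Sum>i = 1..n. real (D i \<omega>))"
    by (intro Bochner_Integration.integrable_sum integrable_demand) auto
  thus "integrable M (\<lambda>\<omega>. real (total_demand D x \<omega> n))"
    by (simp add: total_demand_def)
  have "expectation (\<lambda>\<omega>. \<Sum>i = 1..n. real (D i \<omega>)) =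
      (\<Sum>i = 1..n. expectation (\<lambda>\<omega>. real (D i \<omega>)))"
    by (intro Bochner_Integration.integral_sum integrable_demand) auto
  also have "\<dots> = (\<Sum>i = 1..n. mean_demand)"
    unfolding mean_demand_def by (intro sum.cong refl expectation_demand) auto
  finally have "expectation (\<lambda>\<omega>. \<Sum>i = 1..n. real (D i \<omega>)) = (\<Sum>i = 1..n. mean_demand)" .
  with int show "expectation (\<lambda>\<omega>. real (total_demand D x \<omega> n)) =
      real (fst (snd x)) + real n * mean_demand"
    by (simp add: total_demand_def prob_space)
qed

text \<open>Dropping the holding cost leaves at most \<open>r\<close> times the demand; the initial
  backorders disappear on division by \<open>N\<close>.\<close>

lemma average_profit_le:
  assumes "r > 0" "h > 0"
  shows "average_profit M D \<xi> \<pi> r h x \<le> ereal (r * mean_demand)"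
proof -
  let ?b = "real (fst (snd x))"
  let ?f = "\<lambda>N \<omega>. \<Sum>i = 1..N. period_profit r h (D i \<omega>) (state_after D \<xi> \<pi> x \<omega> (i - 1))"
  have le: "ext_expectation M (?f N) \<le> ereal (r * (?b + real N * mean_demand))" for N
  proof -
    \<comment> \<open>The bound is only almost sure, since \<xi> is known to be at most 1 outside a
      null set. Comparing extended expectations also covers policies with infinite expected holding
      cost.\<close>
    have "AE \<omega> in M. ?f N \<omega> \<le> r * real (total_demand D x \<omega> N)"
      using AE_stay_le_one
    proof eventually_elim
      case (elim \<omega>)
      have "r * real (total_sales D \<xi> x \<omega> \<pi> N) \<le> r * real (total_demand D x \<omega> N)"
        using total_sales_le_total_demand[of \<xi> \<omega> D x \<pi> N] elim \<open>r > 0\<close>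
        by (intro mult_left_mono) auto
      moreover have "0 \<le> h * (\<Sum>i = 1..N. real (fst (state_after D \<xi> \<pi> x \<omega> i)))"
        using \<open>h > 0\<close> by (intro mult_nonneg_nonneg sum_nonneg) auto
      ultimately show ?case
        unfolding total_profit_eq by linarith
    qed
    from ext_expectation_mono[OF this] show ?thesis
      using expectation_total_demand[of x N] by (simp add: ext_expectation_eq_integral)
  qed
  have "average_profit M D \<xi> \<pi> r h x
      \<le> liminf (\<lambda>N. ereal (r * (?b + real N * mean_demand) / real N))"
    unfolding average_profit_def
  proof (rule Liminf_mono)
    show "\<forall>\<^sub>F N in sequentially. ext_expectation M (?f N) / ereal (real N)
        \<le> ereal (r * (?b + real N * mean_demand) / real N)"
      using eventually_gt_at_top[of 0]
    proof eventually_elim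
      case (elim N)
      have "ext_expectation M (?f N) / ereal (real N)
          \<le> ereal (r * (?b + real N * mean_demand)) / ereal (real N)"
        using elim le[of N] by (intro ereal_divide_right_mono) auto
      thus ?case using elim by simp
    qed
  qed
  also have "(\<lambda>N. r * (?b + real N * mean_demand) / real N) \<longlonglongrightarrow> r * mean_demand"
    using tendsto_affine_over_index[of "r * ?b" "r * mean_demand"] by (simp add: algebra_simps)
  hence "liminf (\<lambda>N. ereal (r * (?b + real N * mean_demand) / real N)) = ereal (r * mean_demand)"
    by (intro lim_imp_Liminf) auto
  finally show ?thesis .
qed

text \<open>Lost revenue comes from the excess of \<tau> + 1 demands per period, the cost from
  on-hand stock never exceeding \<open>s\<close>. The assumption on \<open>m\<close> puts the
  initial position below \<open>s\<close>, as the pathwise estimate requires.\<close>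

lemma average_profit_base_stock_ge:
  assumes "r > 0" "h > 0" "valid_state \<tau> x"
    and s: "s = (\<tau> + 1) * m"
    and m: "fst x + sum_list (snd (snd x)) \<le> m"
  shows "average_profit M D \<xi> (sq_policy s 0) r h x
           \<ge> ereal (r * (mean_demand - real (\<tau> + 1) * mean_excess m) - h * real s)"
proof -
  let ?f = "\<lambda>N \<omega>. \<Sum>i = 1..N. period_profit r h (D i \<omega>)
    (state_after D \<xi> (sq_policy s 0) x \<omega> (i - 1))"
  \<comment> \<open>Starting at \<open>Suc \<tau>\<close> keeps every index \<open>k\<close> at
    least 1, where \<open>D k\<close> has the common law.\<close>
  let ?E = "\<lambda>N \<omega>. \<Sum>j = Suc \<tau>..N. \<Sum>k = j - \<tau>..j. real (D k \<omega> - m)"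
  let ?e = "real (\<tau> + 1) * mean_excess m"
  \<comment> \<open>A minorant of the profit that involves demands only, so its integrability and
    expectation follow from theirs.\<close>
  define g where "g N \<omega> = r * (real (total_demand D x \<omega> N) - real (total_demand D x \<omega> \<tau>) - ?E N \<omega>)
      - h * (real N * real s)" for N \<omega>
  have len: "length (snd (snd x)) = \<tau>"
    using assms(3) by (auto simp: valid_state_def)
  have pos: "fst x + sum_list (snd (snd x)) \<le> s"
    using m s by simp
  have intE: "integrable M (?E N)" for N
    by (intro Bochner_Integration.integrable_sum integrable_excess) auto
  have expE: "expectation (?E N) = real (N - \<tau>) * ?e" for N
  proof -
    have "expectation (?E N) = (\<Sum>j = Suc \<tau>..N. \<Sum>k = j - \<tau>..j. expectation (\<lambda>\<omega>. real (D k \<omega> - m)))"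
      by (subst Bochner_Integration.integral_sum,
          fastforce intro!: Bochner_Integration.integrable_sum integrable_excess,
          intro sum.cong refl, subst Bochner_Integration.integral_sum)
        (auto intro!: integrable_excess)
    also have "\<dots> = (\<Sum>j = Suc \<tau>..N. \<Sum>k = j - \<tau>..j. mean_excess m)"
      unfolding mean_excess_def
      by (intro sum.cong refl expectation_demand[of _ "\<lambda>d. real (d - m)"]) auto
    also have "\<dots> = (\<Sum>j = Suc \<tau>..N. ?e)"
      by (intro sum.cong) auto
    finally show ?thesis by simp
  qed
  have excess_nonneg: "mean_excess m \<ge> 0"
    by (simp add: mean_excess_def)
  have ge: "ext_expectation M (?f N) \<ge>
      ereal (r * (real N * mean_demand - real \<tau> * mean_demand - real N * ?e) - h * (real N * real s))"
    for N
  proof -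
    have "g N \<omega> \<le> ?f N \<omega>" for \<omega>
    proof -
      have "real (total_demand D x \<omega> N) \<le>
          real (total_sales D \<xi> x \<omega> (sq_policy s 0) N) + real (total_demand D x \<omega> \<tau>) + ?E N \<omega>"
        using of_nat_mono[OF total_demand_le_base_stock_sales[OF lead_time len pos s, of D \<omega> N \<xi>],
            where 'a = real]
        by simp
      hence "r * (real (total_demand D x \<omega> N) - real (total_demand D x \<omega> \<tau>) - ?E N \<omega>)
          \<le> r * real (total_sales D \<xi> x \<omega> (sq_policy s 0) N)"
        using \<open>r > 0\<close> by (intro mult_left_mono) auto
      moreover have "(\<Sum>i = 1..N. real (fst (state_after D \<xi> (sq_policy s 0) x \<omega> i)))
          \<le> (\<Sum>i = 1..N. real s)"
        using base_stock_position_le[OF lead_time len pos, of D \<xi> \<omega>]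
        by (intro sum_mono of_nat_mono) (meson add_leE)
      hence "h * (\<Sum>i = 1..N. real (fst (state_after D \<xi> (sq_policy s 0) x \<omega> i)))
          \<le> h * (real N * real s)"
        using \<open>h > 0\<close> by (intro mult_left_mono) auto
      ultimately show ?thesis
        unfolding total_profit_eq g_def by linarith
    qed
    hence "ext_expectation M (g N) \<le> ext_expectation M (?f N)"
      by (intro ext_expectation_mono) auto
    moreover have "integrable M (g N)"
      unfolding g_def using expectation_total_demand(1) intE by auto
    moreover have "expectation (g N) = r * (real N * mean_demand - real \<tau> * mean_demand
        - real (N - \<tau>) * ?e) - h * (real N * real s)"
      unfolding g_def using expectation_total_demand[of x] intE expE
      by (simp add: prob_space)
    \<comment> \<open>Replacing the truncated \<open>N - \<tau>\<close> by \<open>N\<close> can only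
      weaken the lower bound, and makes it affine in \<open>N\<close>.\<close>
    moreover have "real (N - \<tau>) * ?e \<le> real N * ?e"
      using excess_nonneg by (intro mult_right_mono) auto
    hence "r * (real N * mean_demand - real \<tau> * mean_demand - real N * ?e)
        \<le> r * (real N * mean_demand - real \<tau> * mean_demand - real (N - \<tau>) * ?e)"
      using \<open>r > 0\<close> by (intro mult_left_mono) auto
    ultimately show ?thesis
      by (simp add: ext_expectation_eq_integral) (erule order_trans[rotated], simp)
  qed
  let ?l = "\<lambda>N. (r * (real N * mean_demand - real \<tau> * mean_demand - real N * ?e)
    - h * (real N * real s)) / real N"
  have "?l \<longlonglongrightarrow> r * (mean_demand - ?e) - h * real s"
    using tendsto_affine_over_index[of "- r * real \<tau> * mean_demand"
        "r * (mean_demand - ?e) - h * real s"]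
    by (simp add: algebra_simps)
  hence "ereal (r * (mean_demand - ?e) - h * real s) = liminf (\<lambda>N. ereal (?l N))"
    by (intro lim_imp_Liminf[symmetric]) auto
  also have "\<dots> \<le> average_profit M D \<xi> (sq_policy s 0) r h x"
    unfolding average_profit_def
  proof (rule Liminf_mono)
    show "\<forall>\<^sub>F N in sequentially. ereal (?l N) \<le> ext_expectation M (?f N) / ereal (real N)"
      using eventually_gt_at_top[of 0]
    proof eventually_elim
      case (elim N)
      thus ?case
        using ereal_divide_right_mono[OF ge[of N], of "ereal (real N)"] by simp
    qed
  qed
  finally show ?thesis .
qed

end

section \<open>Limit of the profit ratio\<close>

lemma ereal_ratio_tendsto_one:
  fixes f g :: "real \<Rightarrow> ereal" and c :: real
  assumes c: "c > 0"
    and fg: "\<forall>\<^sub>F r in at_top. f r \<le> g r" and g: "\<forall>\<^sub>F r in at_top. g r \<le> ereal (r * c)"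
    and f: "\<And>b. b < c \<Longrightarrow> \<forall>\<^sub>F r in at_top. ereal (r * b) \<le> f r"
  shows "((\<lambda>r. f r / g r) \<longlongrightarrow> 1) at_top"
proof (rule order_tendstoI)
  \<comment> \<open>A positive \<open>b\<close> makes both suprema eventually finite and positive,
    so the quotient is one of reals; letting \<open>b\<close> approach \<open>c\<close> drives the
    lower bound to 1.\<close>
  have ratio: "\<forall>\<^sub>F r in at_top. ereal (b / c) \<le> f r / g r \<and> f r / g r \<le> 1"
    if b: "0 < b" "b < c" for b
    using fg g f[OF b(2)] eventually_gt_at_top[of 0]
  proof eventually_elim
    case (elim r)
    have "0 < r * b" using elim b by simp
    obtain u where u: "f r = ereal u"
      using elim by (cases "f r") auto
    obtain v where v: "g r = ereal v"
      using elim u by (cases "g r") auto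
    have le: "r * b \<le> u" "u \<le> v" "v \<le> r * c"
      using elim u v by auto
    have "b / c = (r * b) / (r * c)"
      using elim by simp
    also have "\<dots> \<le> u / v"
      using le \<open>0 < r * b\<close> by (intro frac_le) auto
    finally show ?case
      using le \<open>0 < r * b\<close> u v by (simp add: divide_le_eq)
  qed
  show "\<forall>\<^sub>F r in at_top. a < f r / g r" if a: "a < 1" for a
  proof -
    \<comment> \<open>The maximum with 0 handles negative or infinite \<open>a\<close>; the ratio
      bound is then used with \<open>b = a' * c\<close>.\<close>
    obtain a' where a': "max a 0 < ereal a'" "ereal a' < 1"
      using ereal_dense2[of "max a 0" 1] a by auto
    have "ereal 0 < ereal a'"
      using a' by (intro le_less_trans[OF _ a'(1)]) (simp add: zero_ereal_def)
    hence "0 < a' * c" "a' * c < c"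
      using a' c by (simp_all add: one_ereal_def)
    from ratio[OF this] show ?thesis
      using a' c by (auto elim!: eventually_mono intro: less_le_trans)
  qed
  show "\<forall>\<^sub>F r in at_top. f r / g r < a" if a: "1 < a" for a
    using ratio[of "c / 2"] c a by (auto elim!: eventually_mono intro: le_less_trans)
qed

theorem theorem4:
  fixes M :: "'a measure" and \<tau> :: nat and p h :: real
    and D :: "nat \<Rightarrow> 'a \<Rightarrow> nat" and \<xi> :: "nat \<Rightarrow> nat \<Rightarrow> 'a \<Rightarrow> nat" and x :: state
  assumes "partial_backorder_system M \<tau> p D \<xi>"
    and "h > 0"
    and "\<P>(\<omega> in M. D 1 \<omega> = 0) > 0"
    and "\<P>(\<omega> in M. D 1 \<omega> = 1) > 0"
    and "valid_state \<tau> x"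
  shows "((\<lambda>r. (SUP (s, q). average_profit M D \<xi> (sq_policy s q) r h x)
             / (SUP \<pi>. average_profit M D \<xi> \<pi> r h x)) \<longlongrightarrow> 1) at_top"
proof -
  interpret partial_backorder_system M \<tau> p D \<xi> by fact
  show ?thesis
  proof (rule ereal_ratio_tendsto_one[OF mean_demand_pos])
    show "\<P>(\<omega> in M. D 1 \<omega> = 1) > 0" by fact
    show "\<forall>\<^sub>F r in at_top. (SUP (s, q). average_profit M D \<xi> (sq_policy s q) r h x)
        \<le> (SUP \<pi>. average_profit M D \<xi> \<pi> r h x)"
      by (intro always_eventually allI SUP_least) (auto intro: SUP_upper)
    show "\<forall>\<^sub>F r in at_top. (SUP \<pi>. average_profit M D \<xi> \<pi> r h x) \<le> ereal (r * mean_demand)"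
      using eventually_gt_at_top[of 0]
      by eventually_elim (auto intro!: SUP_least average_profit_le \<open>h > 0\<close>)
  next
    fix b :: real
    assume b: "b < mean_demand"
    have "mean_excess \<longlonglongrightarrow> 0"
      using tendsto_integral_excess[OF demand_mean] by (simp add: mean_excess_def[abs_def])
    hence "(\<lambda>m. mean_demand - real (\<tau> + 1) * mean_excess m)
        \<longlonglongrightarrow> mean_demand - real (\<tau> + 1) * 0"
      by (intro tendsto_intros)
    hence "\<forall>\<^sub>F m in sequentially. b < mean_demand - real (\<tau> + 1) * mean_excess m"
      using b by (intro order_tendstoD(1)) auto
    \<comment> \<open>\<open>m\<close>, and with it \<open>s\<close>, is fixed before
      \<open>r\<close>, so the holding cost bound \<open>h * s\<close> stays constant as
      \<open>r\<close> grows.\<close>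
    then obtain m where m: "b < mean_demand - real (\<tau> + 1) * mean_excess m"
        "fst x + sum_list (snd (snd x)) \<le> m"
      using eventually_happens[OF eventually_conj[OF _ eventually_ge_at_top]] by fastforce
    define c where "c = mean_demand - real (\<tau> + 1) * mean_excess m"
    define s where "s = (\<tau> + 1) * m"
    \<comment> \<open>As \<open>b < c\<close>, the slack \<open>r * (c - b)\<close> eventually
      exceeds the constant \<open>h * s\<close>.\<close>
    have "\<forall>\<^sub>F r in at_top. r * b \<le> r * c - h * real s"
      using m(1) unfolding c_def[symmetric] by real_asymp
    thus "\<forall>\<^sub>F r in at_top.
        ereal (r * b) \<le> (SUP (s, q). average_profit M D \<xi> (sq_policy s q) r h x)"
      using eventually_gt_at_top[of 0]
    proof eventually_elim
      case (elim r)
      have "ereal (r * b) \<le> ereal (r * c - h * real s)"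
        using elim by simp
      also have "\<dots> \<le> average_profit M D \<xi> (sq_policy s 0) r h x"
        unfolding c_def
        by (rule average_profit_base_stock_ge[OF _ _ _ s_def m(2)]) (use elim assms in auto)
      also have "\<dots> \<le> (SUP (s, q). average_profit M D \<xi> (sq_policy s q) r h x)"
        by (rule SUP_upper2[of "(s, 0)"]) auto
      finally show ?case .
    qed
  qed
qed

end
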